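(* In the curved $4$-body problem in $\mathbb S^2$ and in $\mathbb H^2$, the only spherical and hyperbolic rectangular relative equilibria of equal masses, $m_1=m_2=m_3=m_4=:m>0$, occur when the rectangle is a square. That is, for equal masses, if a relative equilibrium in $\mathbb S^2$ (respectively $\mathbb H^2$) is a spherical (respectively hyperbolic) rectangle, then it is a spherical (respectively hyperbolic) square.
   Context: Let $\sigma=1$ for $\mathbb S^2$ and $\sigma=-1$ for $\mathbb H^2$, where $\mathbb S^2=\{(x,y,z)\in\mathbb R^3: x^2+y^2+z^2=1\}$ and $\mathbb H^2=\{(x,y,z): x^2+y^2-z^2=-1,\ z>0\}$. The product $\cdot$ is the standard inner product of signature $(+,+,+)$ for $\mathbb S^2\subset\mathbb R^3$ and the Lorentz inner product of signature $(+,+,-)$ for $\mathbb H^2\subset\mathbb R^{2,1}$. The curved $4$-body problem describes the motion of bodies of masses $m_1,m_2,m_3,m_4>0$ with position vectors ${\bf q}_i=(x_i,y_i,z_i)$ through the equations $$\ddot{\bf q}_i=\sum_{j=1,\,j\ne i}^4\frac{m_j[{\bf q}_j-\sigma({\bf q}_i\cdot{\bf q}_j){\bf q}_i]}{[\sigma-\sigma({\bf q}_i\cdot{\bf q}_j)^2]^{3/2}}-\sigma(\dot{\bf q}_i\cdot\dot{\bf q}_i){\bf q}_i,\qquad i=1,2,3,4,$$ with initial constraints $({\bf q}_i\cdot{\bf q}_i)(0)=\sigma$, $({\bf q}_i\cdot\dot{\bf q}_i)(0)=0$. Configurations with two coinciding bodies, or two antipodal bodies in $\mathbb S^2$, are singular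 and excluded. A relative equilibrium is a solution along which all mutual distances between the bodies remain constant. A spherical (hyperbolic) rectangle is an equiangular geodesic quadrilateral in $\mathbb S^2$ (in $\mathbb H^2$), not contained in a single geodesic (in particular, not lying on a great circle of $\mathbb S^2$); its vertices are then the vertices of a Euclidean rectangle. A spherical (hyperbolic) square is an equiangular equilateral geodesic quadrilateral. A relative equilibrium is rectangular (a square) if its four bodies are at all times the vertices of such a rectangle (square). *)

theory Defs
  imports "HOL-Analysis.Analysis"
begin

text \<open>
  The parameter \<open>\<sigma>\<close> is the sign of the curvature: \<open>\<sigma> = 1\<close> for the unit sphere in Euclidean space
  and \<open>\<sigma> = -1\<close> for the upper sheet of the hyperboloid in Minkowski space.
  Bodies are indexed by the four-element type \<open>4\<close>.
\<close>

definition dot :: "real \<Rightarrow> real^3 \<Rightarrow> real^3 \<Rightarrow> real" where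
  "dot \<sigma> p q = p$1 * q$1 + p$2 * q$2 + \<sigma> * (p$3 * q$3)"

definition S2 :: "(real^3) set" where
  "S2 = {p. (p$1)\<^sup>2 + (p$2)\<^sup>2 + (p$3)\<^sup>2 = 1}"

definition H2 :: "(real^3) set" where
  "H2 = {p. (p$1)\<^sup>2 + (p$2)\<^sup>2 - (p$3)\<^sup>2 = -1 \<and> p$3 > 0}"

definition surface :: "real \<Rightarrow> (real^3) set" where
  "surface \<sigma> = (if \<sigma> = 1 then S2 else H2)"

definition geo_dist :: "real \<Rightarrow> real^3 \<Rightarrow> real^3 \<Rightarrow> real" where
  "geo_dist \<sigma> p q = (if \<sigma> = 1 then arccos (dot \<sigma> p q) else arcosh (- dot \<sigma> p q))"


section \<open>Geodesic quadrilaterals\<close>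

text \<open>Complete geodesics are the nonempty sections of the surface by planes through the origin.\<close>

definition geodesic :: "real \<Rightarrow> (real^3) set \<Rightarrow> bool" where
  "geodesic \<sigma> G \<longleftrightarrow> G \<noteq> {} \<and> (\<exists>n. n \<noteq> 0 \<and> G = {p \<in> surface \<sigma>. n \<bullet> p = 0})"

text \<open>The minimal geodesic arc joining two points that are not antipodal.\<close>

definition geodesic_segment :: "real \<Rightarrow> real^3 \<Rightarrow> real^3 \<Rightarrow> (real^3) set" where
  "geodesic_segment \<sigma> p q =
     {r \<in> surface \<sigma>. \<exists>s\<ge>0. \<exists>t\<ge>0. r = s *\<^sub>R p + t *\<^sub>R q}"

text \<open>Simple closed quadrilateral with the vertices listed in cyclic order.\<close>

definition geodesic_quadrilateral ::
  "real \<Rightarrow> real^3 \<Rightarrow> real^3 \<Rightarrow> real^3 \<Rightarrow> real^3 \<Rightarrow> bool" where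
  "geodesic_quadrilateral \<sigma> a b c d \<longleftrightarrow>
     {a, b, c, d} \<subseteq> surface \<sigma> \<and> distinct [a, b, c, d] \<and>
     a \<noteq> - b \<and> b \<noteq> - c \<and> c \<noteq> - d \<and> d \<noteq> - a \<and>
     geodesic_segment \<sigma> d a \<inter> geodesic_segment \<sigma> a b = {a} \<and>
     geodesic_segment \<sigma> a b \<inter> geodesic_segment \<sigma> b c = {b} \<and>
     geodesic_segment \<sigma> b c \<inter> geodesic_segment \<sigma> c d = {c} \<and>
     geodesic_segment \<sigma> c d \<inter> geodesic_segment \<sigma> d a = {d} \<and>
     geodesic_segment \<sigma> a b \<inter> geodesic_segment \<sigma> c d = {} \<and>
     geodesic_segment \<sigma> b c \<inter> geodesic_segment \<sigma> d a = {}"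

text \<open>
  The projection of \<open>x\<close> to the tangent plane at \<open>p\<close>; it is a positive multiple of the initial
  direction of the geodesic arc from \<open>p\<close> to \<open>x\<close>.
\<close>

definition direction :: "real \<Rightarrow> real^3 \<Rightarrow> real^3 \<Rightarrow> real^3" where
  "direction \<sigma> p x = x - (\<sigma> * dot \<sigma> p x) *\<^sub>R p"

text \<open>
  The angle in \<open>[0, 2\<pi>)\<close> by which the arc from \<open>p\<close> to \<open>x\<close> must be turned counterclockwise about \<open>p\<close>
  to reach the arc from \<open>p\<close> to \<open>y\<close>: for tangent vectors \<open>u\<close>, \<open>v\<close> at \<open>p\<close> enclosing the oriented angle
  \<open>\<theta>\<close>, \<open>dot \<sigma> u v = |u| |v| cos \<theta>\<close> and \<open>det (p, u, v) = |u| |v| sin \<theta>\<close>, where \<open>|u|\<close> is the length with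
  respect to \<open>dot \<sigma>\<close>.
\<close>

definition vertex_angle :: "real \<Rightarrow> real^3 \<Rightarrow> real^3 \<Rightarrow> real^3 \<Rightarrow> real" where
  "vertex_angle \<sigma> p x y =
     (let u = direction \<sigma> p x; v = direction \<sigma> p y
      in Arg2pi (Complex (dot \<sigma> u v) (det (vector [p, u, v] :: real^3^3))))"

text \<open>
  At each vertex the angle from the next edge to the previous one is the interior angle of the region
  to the left of the boundary. Traversing the boundary the other way replaces every angle \<open>\<theta>\<close> by
  \<open>2\<pi> - \<theta>\<close>, so equality of the angles does not depend on the side chosen. Unoriented angles would
  not do: they agree, for instance, along a closed path through the vertices of a regular tetrahedron.
\<close>

definition equiangular :: "real \<Rightarrow> real^3 \<Rightarrow> real^3 \<Rightarrow> real^3 \<Rightarrow> real^3 \<Rightarrow> bool" where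
  "equiangular \<sigma> a b c d \<longleftrightarrow>
     vertex_angle \<sigma> a b d = vertex_angle \<sigma> b c a \<and>
     vertex_angle \<sigma> b c a = vertex_angle \<sigma> c d b \<and>
     vertex_angle \<sigma> c d b = vertex_angle \<sigma> d a c"

definition equilateral :: "real \<Rightarrow> real^3 \<Rightarrow> real^3 \<Rightarrow> real^3 \<Rightarrow> real^3 \<Rightarrow> bool" where
  "equilateral \<sigma> a b c d \<longleftrightarrow>
     geo_dist \<sigma> a b = geo_dist \<sigma> b c \<and>
     geo_dist \<sigma> b c = geo_dist \<sigma> c d \<and>
     geo_dist \<sigma> c d = geo_dist \<sigma> d a"

definition geodesic_rectangle ::
  "real \<Rightarrow> real^3 \<Rightarrow> real^3 \<Rightarrow> real^3 \<Rightarrow> real^3 \<Rightarrow> bool" where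
  "geodesic_rectangle \<sigma> a b c d \<longleftrightarrow>
     geodesic_quadrilateral \<sigma> a b c d \<and> equiangular \<sigma> a b c d \<and>
     \<not> (\<exists>G. geodesic \<sigma> G \<and> {a, b, c, d} \<subseteq> G)"

definition geodesic_square ::
  "real \<Rightarrow> real^3 \<Rightarrow> real^3 \<Rightarrow> real^3 \<Rightarrow> real^3 \<Rightarrow> bool" where
  "geodesic_square \<sigma> a b c d \<longleftrightarrow>
     geodesic_quadrilateral \<sigma> a b c d \<and> equiangular \<sigma> a b c d \<and> equilateral \<sigma> a b c d"


section \<open>The curved four-body problem\<close>

definition acceleration ::
  "real \<Rightarrow> (4 \<Rightarrow> real) \<Rightarrow> (4 \<Rightarrow> real^3) \<Rightarrow> (4 \<Rightarrow> real^3) \<Rightarrow> 4 \<Rightarrow> real^3" where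
  "acceleration \<sigma> m x v i =
     (\<Sum>j \<in> UNIV - {i}.
        (m j / (\<sigma> - \<sigma> * (dot \<sigma> (x i) (x j))\<^sup>2) powr (3/2)) *\<^sub>R
        (x j - (\<sigma> * dot \<sigma> (x i) (x j)) *\<^sub>R x i))
     - (\<sigma> * dot \<sigma> (v i) (v i)) *\<^sub>R x i"

text \<open>
  A twice differentiable solution on an open time interval \<open>I\<close> containing the initial time \<open>0\<close>.
  The condition \<open>q i t \<noteq> - q j t\<close> is vacuous on the hyperboloid.
\<close>

definition curved_solution ::
  "real \<Rightarrow> (4 \<Rightarrow> real) \<Rightarrow> real set \<Rightarrow> (4 \<Rightarrow> real \<Rightarrow> real^3) \<Rightarrow> bool" where
  "curved_solution \<sigma> m I q \<longleftrightarrow>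
     open I \<and> is_interval I \<and> 0 \<in> I \<and>
     (\<forall>t\<in>I. \<forall>i j. i \<noteq> j \<longrightarrow> q i t \<noteq> q j t \<and> q i t \<noteq> - q j t) \<and>
     (\<exists>v. (\<forall>i. q i 0 \<in> surface \<sigma> \<and> dot \<sigma> (q i 0) (v i 0) = 0) \<and>
          (\<forall>t\<in>I. \<forall>i.
             (q i has_vector_derivative v i t) (at t) \<and>
             (v i has_vector_derivative
                acceleration \<sigma> m (\<lambda>j. q j t) (\<lambda>j. v j t) i) (at t)))"

definition relative_equilibrium ::
  "real \<Rightarrow> (4 \<Rightarrow> real) \<Rightarrow> real set \<Rightarrow> (4 \<Rightarrow> real \<Rightarrow> real^3) \<Rightarrow> bool" where
  "relative_equilibrium \<sigma> m I q \<longleftrightarrow>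
     curved_solution \<sigma> m I q \<and>
     (\<forall>i j. \<forall>s\<in>I. \<forall>t\<in>I. geo_dist \<sigma> (q i s) (q j s) = geo_dist \<sigma> (q i t) (q j t))"

text \<open>The order of the bodies along the boundary is not prescribed.\<close>

definition rectangular_motion :: "real \<Rightarrow> real set \<Rightarrow> (4 \<Rightarrow> real \<Rightarrow> real^3) \<Rightarrow> bool" where
  "rectangular_motion \<sigma> I q \<longleftrightarrow>
     (\<forall>t\<in>I. \<exists>a b c d. range (\<lambda>i. q i t) = {a, b, c, d} \<and> geodesic_rectangle \<sigma> a b c d)"

definition square_motion :: "real \<Rightarrow> real set \<Rightarrow> (4 \<Rightarrow> real \<Rightarrow> real^3) \<Rightarrow> bool" where
  "square_motion \<sigma> I q \<longleftrightarrow>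
     (\<forall>t\<in>I. \<exists>a b c d. range (\<lambda>i. q i t) = {a, b, c, d} \<and> geodesic_square \<sigma> a b c d)"

end

theory Submission
  imports Defs
begin

text \<open>
  Equal oriented angles make the dual quadrilateral, formed by the unit poles \<open>n\<^sub>1, \<dots>, n\<^sub>4\<close> of the
  sides, equilateral. Then \<open>n\<^sub>1 - n\<^sub>3\<close> is orthogonal to \<open>n\<^sub>2\<close>, \<open>n\<^sub>4\<close> and \<open>n\<^sub>1 + n\<^sub>3\<close>, so these are coplanar,
  which says that opposite sides are equal; it follows that \<open>a + c = b + d\<close>.

  Along a relative equilibrium all products \<open>q\<^sub>i \<cdot> q\<^sub>j\<close> are constant, so \<open>a + c = b + d\<close> persists and can
  be differentiated. The vectors \<open>u = a - b\<close>, \<open>w = a - d\<close>, \<open>z = a + c\<close> form a rigidly moving orthogonal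
  frame, and by the symmetry of the forces \<open>u'' = p u\<close>, \<open>w'' = r w\<close>, \<open>z'' = k z\<close> with \<open>k > p\<close>, \<open>k > r\<close>.
  Such a frame can only rotate about \<open>z\<close>, which forces \<open>p = r\<close>: the attractions along the two kinds
  of sides agree. They determine \<open>a \<cdot> b\<close> and \<open>b \<cdot> c\<close> up to sign, and opposite signs are
  impossible because \<open>z\<close> would be a null vector.
\<close>

subsection \<open>Equiangular quadrilaterals\<close>

lemmas vec3_simps = dot_def direction_def cross3_def inner_vec_def sum_3 vector_3

lemma surface_dot_self: "\<sigma> = 1 \<or> \<sigma> = -1 \<Longrightarrow> p \<in> surface \<sigma> \<Longrightarrow> dot \<sigma> p p = \<sigma>"
  by (auto simp: surface_def S2_def H2_def dot_def power2_eq_square)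

lemma surface_third: "p \<in> surface (-1) \<Longrightarrow> p$3 > 0"
  by (auto simp: surface_def H2_def)

lemma dot_sym: "dot \<sigma> p q = dot \<sigma> q p"
  by (simp add: dot_def mult.commute)

lemma bilinear_dot: "bilinear (dot \<sigma>)"
  by (auto simp: bilinear_def linear_iff dot_def algebra_simps)

lemmas dot_linear [simp] =
  bilinear_ladd[OF bilinear_dot] bilinear_radd[OF bilinear_dot]
  bilinear_lsub[OF bilinear_dot] bilinear_rsub[OF bilinear_dot]
  bilinear_lmul[OF bilinear_dot] bilinear_rmul[OF bilinear_dot]
  bilinear_lzero[OF bilinear_dot] bilinear_rzero[OF bilinear_dot]

lemma dot_direction:
  assumes "\<sigma> = 1 \<or> \<sigma> = -1" "p \<in> surface \<sigma>" 
  shows "dot \<sigma> p (direction \<sigma> p x) = 0"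
    and "dot \<sigma> (direction \<sigma> p x) (direction \<sigma> p y) = dot \<sigma> x y - \<sigma> * (dot \<sigma> p x * dot \<sigma> p y)"
  using assms surface_dot_self[OF assms]
  by (auto simp: direction_def dot_sym[of _ x p])

text \<open>On the hyperboloid the form is indefinite, but its restriction to a tangent plane is
  positive definite: multiplying by the square of \<open>p$3\<close> and eliminating
  \<open>u$3\<close> by orthogonality leaves a sum of squares, by Lagrange's identity.\<close>

lemma dot_self_tangent_pos:
  assumes \<sigma>: "\<sigma> = 1 \<or> \<sigma> = -1" and p: "p \<in> surface \<sigma>" and u: "dot \<sigma> p u = 0" "u \<noteq> 0"
  shows "dot \<sigma> u u > 0"
  using \<sigma>
proof
  assume 1: "\<sigma> = 1"
  have "dot 1 u u = u \<bullet> u" by (simp add: vec3_simps)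
  then show ?thesis using 1 u by simp
next
  assume 1: "\<sigma> = -1"
  have p3: "p$3 > 0" and pp: "(p$3)\<^sup>2 = 1 + (p$1)\<^sup>2 + (p$2)\<^sup>2"
    using p 1 by (auto simp: surface_def H2_def)
  have ort: "p$1 * u$1 + p$2 * u$2 = p$3 * u$3"
    using u 1 by (simp add: dot_def)
  have "u$1 \<noteq> 0 \<or> u$2 \<noteq> 0"
    using ort p3 u(2) by (auto simp: vec_eq_iff forall_3)
  then have pos: "(u$1)\<^sup>2 + (u$2)\<^sup>2 > 0"
    by (simp add: sum_power2_gt_zero_iff)
  have "(p$3)\<^sup>2 * dot \<sigma> u u = (p$3)\<^sup>2 * ((u$1)\<^sup>2 + (u$2)\<^sup>2) - (p$3 * u$3)\<^sup>2"
    by (simp add: 1 dot_def power2_eq_square algebra_simps)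
  also have "\<dots> = (u$1)\<^sup>2 + (u$2)\<^sup>2 + (p$1 * u$2 - p$2 * u$1)\<^sup>2"
    unfolding ort[symmetric] pp by (simp add: power2_eq_square algebra_simps)
  finally have "(p$3)\<^sup>2 * dot \<sigma> u u > 0"
    using pos by (smt (verit) zero_le_power2)
  then show ?thesis by (simp add: zero_less_mult_iff)
qed

text \<open>The quantity is the squared length of \<open>direction \<sigma> p x\<close>, that is,
  the squared sine or hyperbolic sine of the distance. It can vanish only if \<open>x\<close> is a
  multiple of \<open>p\<close>.\<close>

lemma side_pos:
  assumes \<sigma>: "\<sigma> = 1 \<or> \<sigma> = -1" and p: "p \<in> surface \<sigma>" and x: "x \<in> surface \<sigma>"
    and "x \<noteq> p" "x \<noteq> - p"
  shows "\<sigma> - \<sigma> * (dot \<sigma> p x)\<^sup>2 > 0"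
proof -
  let ?k = "\<sigma> * dot \<sigma> p x"
  have "direction \<sigma> p x \<noteq> 0"
  proof
    assume "direction \<sigma> p x = 0"
    then have xp: "x = ?k *\<^sub>R p" by (simp add: direction_def)
    have "dot \<sigma> x x = ?k\<^sup>2 * dot \<sigma> p p"
      by (subst xp, subst (2) xp) (simp add: power2_eq_square)
    then have "?k\<^sup>2 = 1"
      using surface_dot_self[OF \<sigma> p] surface_dot_self[OF \<sigma> x] \<sigma> by auto
    then have "?k = 1 \<or> ?k = -1" by (simp add: power2_eq_1_iff)
    with xp assms show False by (metis scaleR_one scaleR_minus1_left)
  qed
  then have "dot \<sigma> (direction \<sigma> p x) (direction \<sigma> p x) > 0"
    using dot_self_tangent_pos[OF \<sigma> p] dot_direction[OF \<sigma> p] by blast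
  then show ?thesis
    using dot_direction(2)[OF \<sigma> p, of x x] surface_dot_self[OF \<sigma> x] by (simp add: power2_eq_square)
qed

text \<open>The functions \<open>arccos\<close> and \<open>arcosh\<close> are injective where they
  are evaluated: the product lies in [-1, 1] on the sphere and is at most -1 on the
  hyperboloid.\<close>

lemma geo_dist_eq_iff:
  assumes \<sigma>: "\<sigma> = 1 \<or> \<sigma> = -1"
    and "p \<in> surface \<sigma>" "q \<in> surface \<sigma>" "p' \<in> surface \<sigma>" "q' \<in> surface \<sigma>"
  shows "geo_dist \<sigma> p q = geo_dist \<sigma> p' q' \<longleftrightarrow> dot \<sigma> p q = dot \<sigma> p' q'"
proof -
  have bound: "\<sigma> - \<sigma> * (dot \<sigma> x y)\<^sup>2 \<ge> 0" if "x \<in> surface \<sigma>" "y \<in> surface \<sigma>" for x y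
  proof (cases "y = x \<or> y = - x")
    case True
    then show ?thesis
      using surface_dot_self[OF \<sigma> that(1)] \<sigma> bilinear_rneg[OF bilinear_dot, of \<sigma> x x] by auto
  qed (use side_pos[OF \<sigma> that] in simp)
  show ?thesis
    using \<sigma>
  proof
    assume 1: "\<sigma> = 1"
    have "\<bar>dot \<sigma> x y\<bar> \<le> 1" if "x \<in> surface \<sigma>" "y \<in> surface \<sigma>" for x y
      using bound[OF that] 1 by (simp add: abs_square_le_1)
    then show ?thesis
      using assms 1 by (simp add: geo_dist_def arccos_eq_iff)
  next
    assume 1: "\<sigma> = -1"
    have "- dot \<sigma> x y \<ge> 1" if "x \<in> surface \<sigma>" "y \<in> surface \<sigma>" for x y
    proof -
      \<comment> \<open>Cauchy-Schwarz in the horizontal plane, together with positive third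
        coordinates, fixes the sign of the product; \<open>bound\<close> controls only its absolute
        value.\<close>
      have "(x$1 * y$1 + x$2 * y$2)\<^sup>2 \<le> ((x$1)\<^sup>2 + (x$2)\<^sup>2) * ((y$1)\<^sup>2 + (y$2)\<^sup>2)"
        using zero_le_power2[of "x$1 * y$2 - x$2 * y$1"]
        by (simp add: power2_eq_square algebra_simps)
      also have "\<dots> \<le> (x$3)\<^sup>2 * (y$3)\<^sup>2"
        using that 1 by (intro mult_mono) (auto simp: surface_def H2_def)
      finally have "x$1 * y$1 + x$2 * y$2 \<le> x$3 * y$3"
        using surface_third that 1
        by (metis abs_le_square_iff abs_le_D1 abs_of_pos mult_pos_pos power_mult_distrib)
      then have "dot \<sigma> x y \<le> 0" by (simp add: dot_def 1)
      moreover have "\<bar>dot \<sigma> x y\<bar> \<ge> 1"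
        using bound[OF that] 1 abs_le_square_iff[of 1 "dot \<sigma> x y"] by simp
      ultimately show ?thesis by simp
    qed
    then have "arcosh (- dot \<sigma> p q) = arcosh (- dot \<sigma> p' q') \<longleftrightarrow> dot \<sigma> p q = dot \<sigma> p' q'"
      using assms by (metis cosh_arcosh_real neg_equal_iff_equal)
    then show ?thesis using 1 by (simp add: geo_dist_def)
  qed
qed

text \<open>The complex number whose argument is the vertex angle has modulus \<open>l * r\<close>,
  by the Gram determinant of \<open>p\<close>, \<open>x\<close>, \<open>y\<close>. Its real and
  imaginary parts are thus expressed without reference to \<open>Arg2pi\<close>.\<close>

lemma vertex_angle_cos_sin:
  fixes p x y :: "real^3"
  assumes \<sigma>: "\<sigma> = 1 \<or> \<sigma> = -1" and S: "p \<in> surface \<sigma>" "x \<in> surface \<sigma>" "y \<in> surface \<sigma>"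
  defines "\<theta> \<equiv> vertex_angle \<sigma> p x y"
    and "l \<equiv> sqrt (\<sigma> - \<sigma> * (dot \<sigma> p x)\<^sup>2)" and "r \<equiv> sqrt (\<sigma> - \<sigma> * (dot \<sigma> p y)\<^sup>2)"
  assumes "x \<noteq> p" "x \<noteq> - p" "y \<noteq> p" "y \<noteq> - p"
  shows "dot \<sigma> x y - \<sigma> * (dot \<sigma> p x * dot \<sigma> p y) = l * r * cos \<theta>"
    and "p \<bullet> (cross3 x y) = l * r * sin \<theta>"
proof -
  let ?u = "direction \<sigma> p x" and ?v = "direction \<sigma> p y"
  define z where "z = Complex (dot \<sigma> ?u ?v) (p \<bullet> cross3 x y)"
  \<comment> \<open>Projecting to the tangent plane only subtracts multiples of \<open>p\<close>, so
    the determinant does not change.\<close>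
  have det: "det (vector [p, ?u, ?v] :: real^3^3) = p \<bullet> cross3 x y"
    unfolding dot_cross_det[symmetric]
    by (simp add: vec3_simps) (simp add: algebra_simps)
  have \<theta>: "\<theta> = Arg2pi z"
    by (simp add: \<theta>_def vertex_angle_def Let_def det z_def)
  have pos: "\<sigma> - \<sigma> * (dot \<sigma> p x)\<^sup>2 > 0" "\<sigma> - \<sigma> * (dot \<sigma> p y)\<^sup>2 > 0"
    using side_pos \<sigma> S assms by blast+
  \<comment> \<open>The right-hand side is the Gram determinant expanded along its first row; the
    factor \<open>\<sigma>\<close> is the determinant of the form.\<close>
  have gram: "(p \<bullet> cross3 x y)\<^sup>2 * \<sigma> =
      dot \<sigma> p p * (dot \<sigma> x x * dot \<sigma> y y - (dot \<sigma> x y)\<^sup>2)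
      - dot \<sigma> p x * (dot \<sigma> p x * dot \<sigma> y y - dot \<sigma> x y * dot \<sigma> p y)
      + dot \<sigma> p y * (dot \<sigma> p x * dot \<sigma> x y - dot \<sigma> x x * dot \<sigma> p y)"
    using \<sigma> by (auto simp: vec3_simps power2_eq_square algebra_simps)
  have "(cmod z)\<^sup>2 = (dot \<sigma> x y - \<sigma> * (dot \<sigma> p x * dot \<sigma> p y))\<^sup>2 + (p \<bullet> cross3 x y)\<^sup>2"
    unfolding z_def cmod_power2 by (simp add: dot_direction[OF \<sigma> S(1)])
  also have "\<dots> = (\<sigma> - \<sigma> * (dot \<sigma> p x)\<^sup>2) * (\<sigma> - \<sigma> * (dot \<sigma> p y)\<^sup>2)"
    using gram \<sigma> unfolding S[THEN surface_dot_self[OF \<sigma>]]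
    by (auto simp: power2_eq_square algebra_simps)
  also have "\<dots> = (l * r)\<^sup>2"
    using pos by (simp add: l_def r_def power_mult_distrib)
  finally have "cmod z = l * r"
    using pos by (simp add: l_def r_def power2_eq_iff_nonneg)
  then show "dot \<sigma> x y - \<sigma> * (dot \<sigma> p x * dot \<sigma> p y) = l * r * cos \<theta>"
    and "p \<bullet> (cross3 x y) = l * r * sin \<theta>"
    using cos_Arg2pi[of z] sin_Arg2pi[of z] by (simp_all add: \<theta> z_def dot_direction[OF \<sigma> S(1)])
qed


section \<open>The dual quadrilateral and the parallelogram relation\<close>

lemma triple_product_zero:
  assumes "w \<noteq> 0" "w \<bullet> x = 0" "w \<bullet> y = 0" "w \<bullet> z = 0"
  shows "x \<bullet> cross3 y z = 0"
proof -
  have "(x \<bullet> cross3 y z) *\<^sub>R w =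
      (w \<bullet> x) *\<^sub>R cross3 y z + (w \<bullet> y) *\<^sub>R cross3 z x + (w \<bullet> z) *\<^sub>R cross3 x y"
    by (simp add: vec_eq_iff forall_3 vec3_simps) (simp add: algebra_simps)
  with assms show ?thesis by simp
qed

text \<open>This is the Binet-Cauchy identity. Since \<open>cross3\<close> is the Euclidean product,
  the cofactor matrix of diag(1, 1, \<sigma>) enters, which is \<sigma> times that matrix.\<close>

lemma dot_cross3:
  assumes "\<sigma> = 1 \<or> \<sigma> = -1"
  shows "dot \<sigma> (cross3 p q) (cross3 r s) = \<sigma> * (dot \<sigma> p r * dot \<sigma> q s - dot \<sigma> p s * dot \<sigma> q r)"
  using assms by (auto simp: vec3_simps algebra_simps)

text \<open>Multiplication by the matrix of the form. It turns orthogonality for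
  \<open>dot \<sigma>\<close> into Euclidean orthogonality, in which geodesics and triple products
  are expressed.\<close>

definition flip3 :: "real \<Rightarrow> real^3 \<Rightarrow> real^3" where
  "flip3 \<sigma> p = vector [p$1, p$2, \<sigma> * p$3]"

lemma flip3_inner: "flip3 \<sigma> p \<bullet> q = dot \<sigma> p q"
  by (simp add: flip3_def vec3_simps)

lemma flip3_eq_0: "\<sigma> \<noteq> 0 \<Longrightarrow> flip3 \<sigma> p = 0 \<longleftrightarrow> p = 0"
  by (simp add: flip3_def vec_eq_iff forall_3 vector_3)

text \<open>Here \<open>l1\<close> to \<open>l4\<close> are the sines or hyperbolic sines of the
  sides, and \<open>k\<close>, \<open>s\<close> are the cosine and sine of the common angle.
  Coplanarity of \<open>n1 + n3\<close>, \<open>n2\<close>, \<open>n4\<close> becomes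
  \<open>l1 = l3\<close> once the triple products are factored through \<open>sn\<close>.\<close>

lemma equiangular_opposite_sides:
  fixes a b c d :: "real^3"
  assumes \<sigma>: "\<sigma> = 1 \<or> \<sigma> = -1"
    and S: "a \<in> surface \<sigma>" "b \<in> surface \<sigma>" "c \<in> surface \<sigma>" "d \<in> surface \<sigma>"
    and nc: "\<And>n. \<forall>p\<in>{a, b, c, d}. n \<bullet> p = 0 \<Longrightarrow> n = 0"
    and l: "l1\<^sup>2 = \<sigma> - \<sigma> * (dot \<sigma> a b)\<^sup>2" "l2\<^sup>2 = \<sigma> - \<sigma> * (dot \<sigma> b c)\<^sup>2"
      "l3\<^sup>2 = \<sigma> - \<sigma> * (dot \<sigma> c d)\<^sup>2" "l4\<^sup>2 = \<sigma> - \<sigma> * (dot \<sigma> d a)\<^sup>2"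
    and pos: "l1 > 0" "l2 > 0" "l3 > 0" "l4 > 0"
    and cs: "dot \<sigma> b d - \<sigma> * (dot \<sigma> a b * dot \<sigma> a d) = l1 * l4 * k"
      "dot \<sigma> c a - \<sigma> * (dot \<sigma> b c * dot \<sigma> b a) = l2 * l1 * k"
      "dot \<sigma> d b - \<sigma> * (dot \<sigma> c d * dot \<sigma> c b) = l3 * l2 * k"
      "dot \<sigma> a c - \<sigma> * (dot \<sigma> d a * dot \<sigma> d c) = l4 * l3 * k"
    and sn: "a \<bullet> cross3 b d = l1 * l4 * s" "b \<bullet> cross3 c a = l2 * l1 * s"
      "c \<bullet> cross3 d b = l3 * l2 * s" "d \<bullet> cross3 a c = l4 * l3 * s"
  shows "s \<noteq> 0" and "l1 = l3"
proof -
  have sq: "dot \<sigma> p p = \<sigma>" if "p \<in> {a, b, c, d}" for p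
    using surface_dot_self[OF \<sigma>] S that by blast
  have \<sigma>2: "\<sigma> * \<sigma> = 1" using \<sigma> by auto
  \<comment> \<open>These are Euclidean normals of the planes of the sides. In the hyperbolic case
    the poles proper are their images under \<open>flip3 \<sigma>\<close>, which preserves
    \<open>dot \<sigma>\<close>, so the mutual products are the same.\<close>
  define n1 where "n1 = (1 / l1) *\<^sub>R cross3 a b"
  define n2 where "n2 = (1 / l2) *\<^sub>R cross3 b c"
  define n3 where "n3 = (1 / l3) *\<^sub>R cross3 c d"
  define n4 where "n4 = (1 / l4) *\<^sub>R cross3 d a"
  have unit: "dot \<sigma> n1 n1 = 1" "dot \<sigma> n3 n3 = 1"
    using pos l(1,3) \<sigma> by (auto simp: n1_def n3_def dot_cross3 sq dot_sym[of _ b a] dot_sym[of _ d c]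
        power2_eq_square divide_simps)
  have adj: "dot \<sigma> n1 n2 = - k" "dot \<sigma> n2 n3 = - k" "dot \<sigma> n3 n4 = - k" "dot \<sigma> n4 n1 = - k"
    using pos cs \<sigma> by (auto simp: n1_def n2_def n3_def n4_def dot_cross3 sq dot_sym[of _ b a]
        dot_sym[of _ c a] dot_sym[of _ d a] dot_sym[of _ c b] dot_sym[of _ d b] dot_sym[of _ d c]
        divide_simps algebra_simps)
  show s: "s \<noteq> 0"
  proof
    assume "s = 0"
    moreover have "cross3 a b \<bullet> c = b \<bullet> cross3 c a" "cross3 a b \<bullet> d = a \<bullet> cross3 b d"
      by (simp_all add: vec3_simps) (simp_all add: algebra_simps)
    ultimately have "\<forall>p\<in>{a, b, c, d}. n1 \<bullet> p = 0"
      using sn(1,2) by (simp add: n1_def dot_cross_self inner_commute)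
    then have "n1 = 0" by (rule nc)
    then show False using unit by simp
  qed
  \<comment> \<open>Otherwise one plane through the origin would contain all four vertices.\<close>
  have "n1 \<noteq> n3"
  proof
    assume "n1 = n3"
    moreover have "n1 \<bullet> a = 0" "n1 \<bullet> b = 0" "n3 \<bullet> c = 0" "n3 \<bullet> d = 0"
      by (simp_all add: n1_def n3_def dot_cross_self inner_commute)
    ultimately have "n1 = 0" using nc[of n1] by simp
    then show False using unit by simp
  qed
  then have w: "flip3 \<sigma> (n1 - n3) \<noteq> 0"
    using \<sigma> by (auto simp: flip3_eq_0)
  have "(n1 + n3) \<bullet> cross3 n2 n4 = 0"
    by (rule triple_product_zero[OF w])
      (use adj unit in \<open>simp_all add: flip3_inner dot_sym[of _ n3 n1] dot_sym[of _ n3 n2] dot_sym[of _ n1 n4]\<close>)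
  then have "cross3 a b \<bullet> cross3 (cross3 b c) (cross3 d a) / l1
      + cross3 c d \<bullet> cross3 (cross3 b c) (cross3 d a) / l3 = 0"
    using pos by (simp add: n1_def n2_def n3_def n4_def cross_mult_left cross_mult_right
        inner_add_left field_simps)
  \<comment> \<open>A triple product of normals of successive sides factors into the triple products
    at the two vertices between them.\<close>
  moreover have "cross3 a b \<bullet> cross3 (cross3 b c) (cross3 d a) = (a \<bullet> cross3 b d) * (b \<bullet> cross3 c a)"
    by (simp add: vec3_simps) (simp add: algebra_simps)
  moreover have "cross3 c d \<bullet> cross3 (cross3 b c) (cross3 d a) = - (c \<bullet> cross3 d b) * (d \<bullet> cross3 a c)"
    by (simp add: vec3_simps) (simp add: algebra_simps)
  moreover have "(l1 * l4 * s) * (l2 * l1 * s) / l1 = l1 * (l2 * l4 * s\<^sup>2)"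
    "- (l3 * l2 * s) * (l4 * l3 * s) / l3 = - (l3 * (l2 * l4 * s\<^sup>2))"
    using pos by (simp_all add: power2_eq_square)
  ultimately have "l1 * (l2 * l4 * s\<^sup>2) = l3 * (l2 * l4 * s\<^sup>2)"
    unfolding sn by simp
  then show "l1 = l3" using pos s by simp
qed

lemma not_on_geodesic:
  assumes "\<not> (\<exists>G. geodesic \<sigma> G \<and> A \<subseteq> G)" "A \<subseteq> surface \<sigma>" "A \<noteq> {}"
    and "\<forall>p\<in>A. n \<bullet> p = 0"
  shows "n = 0"
proof (rule ccontr)
  assume "n \<noteq> 0"
  moreover have sub: "A \<subseteq> {p \<in> surface \<sigma>. n \<bullet> p = 0}" using assms by blast
  ultimately have "geodesic \<sigma> {p \<in> surface \<sigma>. n \<bullet> p = 0}"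
    using assms(3) unfolding geodesic_def by blast
  with sub assms(1) show False by blast
qed

text \<open>Four vectors in space satisfy a linear relation whose coefficients are triple products.
  Equal angles and equal opposite sides give these a common value up to alternating signs, and this
  value is nonzero.\<close>

lemma geodesic_rectangle_parallelogram:
  assumes \<sigma>: "\<sigma> = 1 \<or> \<sigma> = -1" and rect: "geodesic_rectangle \<sigma> a b c d"
  shows "a - b + c - d = 0" and "a \<bullet> cross3 b c \<noteq> 0"
proof -
  have sub: "{a, b, c, d} \<subseteq> surface \<sigma>" and dist: "distinct [a, b, c, d]"
    and anti: "a \<noteq> - b" "b \<noteq> - c" "c \<noteq> - d" "d \<noteq> - a"
    and eq: "equiangular \<sigma> a b c d"
    and ng: "\<not> (\<exists>G. geodesic \<sigma> G \<and> {a, b, c, d} \<subseteq> G)"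
    using rect by (simp_all add: geodesic_rectangle_def geodesic_quadrilateral_def)
  have S: "a \<in> surface \<sigma>" "b \<in> surface \<sigma>" "c \<in> surface \<sigma>" "d \<in> surface \<sigma>"
    using sub by auto
  have nc: "n = 0" if "\<forall>p\<in>{a, b, c, d}. n \<bullet> p = 0" for n
    using not_on_geodesic[OF ng sub] that by blast
  define \<theta> where "\<theta> = vertex_angle \<sigma> a b d"
  define l where "l p q = sqrt (\<sigma> - \<sigma> * (dot \<sigma> p q)\<^sup>2)" for p q
  have ldc: "l q p = l p q" for p q by (simp add: l_def dot_sym[of _ q p])
  have ne: "b \<noteq> a" "b \<noteq> - a" "d \<noteq> a" "d \<noteq> - a" "c \<noteq> b" "c \<noteq> - b" "a \<noteq> b" "a \<noteq> - b"
    "d \<noteq> c" "d \<noteq> - c" "b \<noteq> c" "b \<noteq> - c" "a \<noteq> d" "a \<noteq> - d" "c \<noteq> d" "c \<noteq> - d"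
    using dist anti anti[THEN not_sym] minus_equation_iff[of a b] minus_equation_iff[of b c]
      minus_equation_iff[of c d] minus_equation_iff[of d a] by auto
  have pos: "l a b > 0" "l b c > 0" "l c d > 0" "l d a > 0"
    unfolding l_def real_sqrt_gt_0_iff by (intro side_pos[OF \<sigma>] S ne)+
  then have lsq: "(l a b)\<^sup>2 = \<sigma> - \<sigma> * (dot \<sigma> a b)\<^sup>2" "(l b c)\<^sup>2 = \<sigma> - \<sigma> * (dot \<sigma> b c)\<^sup>2"
    "(l c d)\<^sup>2 = \<sigma> - \<sigma> * (dot \<sigma> c d)\<^sup>2" "(l d a)\<^sup>2 = \<sigma> - \<sigma> * (dot \<sigma> d a)\<^sup>2"
    by (simp_all add: l_def)
  have angles: "vertex_angle \<sigma> a b d = \<theta>" "vertex_angle \<sigma> b c a = \<theta>"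
    "vertex_angle \<sigma> c d b = \<theta>" "vertex_angle \<sigma> d a c = \<theta>"
    using eq by (auto simp: equiangular_def \<theta>_def)
  note corner = vertex_angle_cos_sin[OF \<sigma>, folded l_def]
  note cs = corner(1)[OF S(1,2,4) ne(1-4)] corner(1)[OF S(2,3,1) ne(5-8)]
    corner(1)[OF S(3,4,2) ne(9-12)] corner(1)[OF S(4,1,3) ne(13-16)]
  note cs = cs[unfolded angles ldc[of a d] ldc[of b a] ldc[of c b] ldc[of d c]]
  note sn = corner(2)[OF S(1,2,4) ne(1-4)] corner(2)[OF S(2,3,1) ne(5-8)]
    corner(2)[OF S(3,4,2) ne(9-12)] corner(2)[OF S(4,1,3) ne(13-16)]
  note sn = sn[unfolded angles ldc[of a d] ldc[of b a] ldc[of c b] ldc[of d c]]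
  have nc': "n = 0" if "\<forall>p\<in>{b, c, d, a}. n \<bullet> p = 0" for n
    using nc that by blast
  have r1: "sin \<theta> \<noteq> 0" "l a b = l c d"
    using equiangular_opposite_sides[OF \<sigma> S _ lsq pos cs sn] nc by blast+
  \<comment> \<open>The other pair of opposite sides follows by shifting the labels
    cyclically.\<close>
  have r2: "l b c = l d a"
    using equiangular_opposite_sides(2)[OF \<sigma> S(2,3,4,1) _ lsq(2,3,4,1) pos(2,3,4,1)
      cs(2,3,4,1) sn(2,3,4,1)] nc' by blast
  let ?D = "l a b * l b c * sin \<theta>"
  have D: "?D \<noteq> 0" using pos r1(1) by simp
  have "(c \<bullet> cross3 d b) *\<^sub>R a - (d \<bullet> cross3 a c) *\<^sub>R b
      + (a \<bullet> cross3 b d) *\<^sub>R c - (b \<bullet> cross3 c a) *\<^sub>R d = 0"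
    by (simp add: vec_eq_iff forall_3 vec3_simps) (simp add: algebra_simps)
  then have "?D *\<^sub>R (a - b + c - d) = 0"
    unfolding sn r1(2)[symmetric] r2[symmetric] by (simp add: algebra_simps)
  then show "a - b + c - d = 0" using D by (metis scaleR_eq_0_iff)
  have "a \<bullet> cross3 b c = b \<bullet> cross3 c a"
    by (simp add: vec3_simps) (simp add: algebra_simps)
  then show "a \<bullet> cross3 b c \<noteq> 0" using sn(2) pos r1(1) by simp
qed


subsection \<open>Rigidly moving frames\<close>

text \<open>The form may be indefinite, so nonzero squares come from nondegeneracy: a null member of
  the frame would be orthogonal to the whole frame. The same argument kills the remainder after
  projecting \<open>y\<close> on the frame.\<close>

lemma orthogonal_expansion:
  assumes basis: "\<forall>w. dot \<sigma> w u = 0 \<and> dot \<sigma> w v = 0 \<and> dot \<sigma> w c = 0 \<longrightarrow> w = 0"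
    and ort: "dot \<sigma> u v = 0" "dot \<sigma> u c = 0" "dot \<sigma> v c = 0"
    and nz: "u \<noteq> 0" "v \<noteq> 0" "c \<noteq> 0"
  shows "dot \<sigma> u u \<noteq> 0" and "dot \<sigma> v v \<noteq> 0" and "dot \<sigma> c c \<noteq> 0"
    and "dot \<sigma> x y = dot \<sigma> x u * dot \<sigma> y u / dot \<sigma> u u
      + dot \<sigma> x v * dot \<sigma> y v / dot \<sigma> v v + dot \<sigma> x c * dot \<sigma> y c / dot \<sigma> c c"
proof -
  note ort' = ort ort[unfolded dot_sym[of \<sigma> u v] dot_sym[of \<sigma> u c] dot_sym[of \<sigma> v c]]
  show n: "dot \<sigma> u u \<noteq> 0" "dot \<sigma> v v \<noteq> 0" "dot \<sigma> c c \<noteq> 0"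
    using basis[rule_format, of u] basis[rule_format, of v] basis[rule_format, of c] nz ort' by auto
  define r where "r = y - (dot \<sigma> y u / dot \<sigma> u u) *\<^sub>R u - (dot \<sigma> y v / dot \<sigma> v v) *\<^sub>R v
      - (dot \<sigma> y c / dot \<sigma> c c) *\<^sub>R c"
  have "r = 0"
    by (rule basis[rule_format]) (use n ort' in \<open>simp_all add: r_def\<close>)
  then have "dot \<sigma> x r = 0" by simp
  then show "dot \<sigma> x y = dot \<sigma> x u * dot \<sigma> y u / dot \<sigma> u u
      + dot \<sigma> x v * dot \<sigma> y v / dot \<sigma> v v + dot \<sigma> x c * dot \<sigma> y c / dot \<sigma> c c"
    by (simp add: r_def algebra_simps)
qed

text \<open>
  If an orthogonal frame moves rigidly and its vectors satisfy \<open>u'' = p u\<close>, \<open>v'' = r v\<close>,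
  \<open>c'' = k c\<close>, then all products of two distinct angular velocity components vanish, so the frame
  rotates about one of its own axes, and the two vectors moved by the rotation have the same factor.
\<close>

lemma rotating_frame_factors:
  assumes basis: "\<forall>w. dot \<sigma> w u = 0 \<and> dot \<sigma> w v = 0 \<and> dot \<sigma> w c = 0 \<longrightarrow> w = 0"
    and ort: "dot \<sigma> u v = 0" "dot \<sigma> u c = 0" "dot \<sigma> v c = 0"
    and nz: "u \<noteq> 0" "v \<noteq> 0" "c \<noteq> 0"
    and first: "dot \<sigma> u' u = 0" "dot \<sigma> v' v = 0" "dot \<sigma> c' c = 0"
      "dot \<sigma> u' v + dot \<sigma> u v' = 0" "dot \<sigma> u' c + dot \<sigma> u c' = 0" "dot \<sigma> v' c + dot \<sigma> v c' = 0"
    and second: "dot \<sigma> u' v' = 0" "dot \<sigma> u' c' = 0" "dot \<sigma> v' c' = 0"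
      "dot \<sigma> u' u' = - p * dot \<sigma> u u" "dot \<sigma> v' v' = - r * dot \<sigma> v v"
      "dot \<sigma> c' c' = - k * dot \<sigma> c c"
    and "k \<noteq> p" "k \<noteq> r"
  shows "p = r"
proof -
  note expand = orthogonal_expansion(4)[OF basis ort nz]
  note n = orthogonal_expansion(1-3)[OF basis ort nz]
  \<comment> \<open>Up to scaling, these are the components of the angular velocity in the
    frame.\<close>
  define x y z where "x = dot \<sigma> u' v" and "y = dot \<sigma> u' c" and "z = dot \<sigma> v' c"
  have val: "dot \<sigma> u' v = x" "dot \<sigma> u' c = y" "dot \<sigma> v' c = z"
    "dot \<sigma> v' u = - x" "dot \<sigma> c' u = - y" "dot \<sigma> c' v = - z"
    using first dot_sym[of \<sigma> v' u] dot_sym[of \<sigma> c' u] dot_sym[of \<sigma> c' v]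
    by (simp_all add: x_def y_def z_def)
  \<comment> \<open>In the expansion of each mixed product of velocities only one term survives,
    namely the one along the third frame vector.\<close>
  have "y * z = 0" "x * z = 0" "x * y = 0"
    using second(1-3) n unfolding expand[of u' v'] expand[of u' c'] expand[of v' c']
    by (simp_all add: val first(1-3))
  then consider "y = 0" "z = 0" | "x = 0" "z = 0" | "x = 0" "y = 0" by auto
  moreover have sq: "x\<^sup>2 / dot \<sigma> v v + y\<^sup>2 / dot \<sigma> c c = - p * dot \<sigma> u u"
    "x\<^sup>2 / dot \<sigma> u u + z\<^sup>2 / dot \<sigma> c c = - r * dot \<sigma> v v"
    "y\<^sup>2 / dot \<sigma> u u + z\<^sup>2 / dot \<sigma> v v = - k * dot \<sigma> c c"
    using second(4-6) unfolding expand[of u' u'] expand[of v' v'] expand[of c' c']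
    by (simp_all add: val first(1-3) power2_eq_square)
  ultimately show "p = r"
  proof cases
    case 1
    then have "p * (dot \<sigma> u u * dot \<sigma> v v) = r * (dot \<sigma> u u * dot \<sigma> v v)"
      using sq(1,2) n by (simp add: field_simps)
    then show ?thesis using n by simp
  next
    \<comment> \<open>A rotation about \<open>v\<close>, or about \<open>u\<close> in the last case,
      would equate \<open>k\<close> with \<open>p\<close> or \<open>r\<close>.\<close>
    case 2
    then have "p * (dot \<sigma> u u * dot \<sigma> c c) = k * (dot \<sigma> u u * dot \<sigma> c c)"
      using sq(1,3) n by (simp add: field_simps)
    then show ?thesis using n \<open>k \<noteq> p\<close> by simp
  next
    case 3
    then have "r * (dot \<sigma> v v * dot \<sigma> c c) = k * (dot \<sigma> v v * dot \<sigma> c c)"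
      using sq(2,3) n by (simp add: field_simps)
    then show ?thesis using n \<open>k \<noteq> r\<close> by simp
  qed
qed

section \<open>Differentiating constant products\<close>

lemma bounded_bilinear_dot: "bounded_bilinear (dot \<sigma>)"
  using bilinear_conv_bounded_bilinear bilinear_dot by blast

lemma constant_on_open_derivative:
  fixes f :: "real \<Rightarrow> 'a::real_normed_vector"
  assumes "(f has_vector_derivative d) (at s)" "open I" "s \<in> I" "\<And>s. s \<in> I \<Longrightarrow> f s = e"
  shows "d = 0"
proof -
  have "(f has_vector_derivative 0) (at s)"
    by (rule has_vector_derivative_transform_within_open[OF _ assms(2,3) assms(4)[symmetric]])
      simp_all
  with assms(1) show ?thesis using vector_derivative_unique_at by blast
qed

text \<open>The first identity holds throughout \<open>I\<close>, so it can be differentiated once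
  more at \<open>t\<close>, where only the second derivatives at \<open>t\<close> enter.\<close>

lemma constant_dot_derivatives:
  assumes "open I"
    and const: "\<And>s. s \<in> I \<Longrightarrow> dot \<sigma> (x s) (y s) = k"
    and x: "\<And>s. s \<in> I \<Longrightarrow> (x has_vector_derivative x' s) (at s)"
    and y: "\<And>s. s \<in> I \<Longrightarrow> (y has_vector_derivative y' s) (at s)"
    and t: "t \<in> I"
  shows "dot \<sigma> (x' t) (y t) + dot \<sigma> (x t) (y' t) = 0"
    and "(x' has_vector_derivative x'') (at t) \<Longrightarrow> (y' has_vector_derivative y'') (at t) \<Longrightarrow>
      dot \<sigma> x'' (y t) + 2 * dot \<sigma> (x' t) (y' t) + dot \<sigma> (x t) y'' = 0"
proof -
  note zero = constant_on_open_derivative[OF _ \<open>open I\<close>]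
  note prod = bounded_bilinear.has_vector_derivative[OF bounded_bilinear_dot]
  have one: "dot \<sigma> (x s) (y' s) + dot \<sigma> (x' s) (y s) = 0" if "s \<in> I" for s
    using zero[OF prod[OF x[OF that] y[OF that]] that const] by blast
  then show "dot \<sigma> (x' t) (y t) + dot \<sigma> (x t) (y' t) = 0"
    using t by (simp add: add.commute)
  assume 2: "(x' has_vector_derivative x'') (at t)" "(y' has_vector_derivative y'') (at t)"
  have "dot \<sigma> (x t) y'' + dot \<sigma> (x' t) (y' t) + (dot \<sigma> (x' t) (y' t) + dot \<sigma> x'' (y t)) = 0"
    using zero[OF has_vector_derivative_add[OF prod[OF x[OF t] 2(2)] prod[OF 2(1) y[OF t]]] t one]
    by blast
  then show "dot \<sigma> x'' (y t) + 2 * dot \<sigma> (x' t) (y' t) + dot \<sigma> (x t) y'' = 0" by simp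
qed


subsection \<open>Equal masses at the vertices of a parallelogram\<close>

lemma independent_triple:
  assumes "a \<bullet> cross3 b c \<noteq> 0" "x *\<^sub>R a + y *\<^sub>R b + z *\<^sub>R c = 0"
  shows "x = 0" and "y = 0" and "z = 0"
proof -
  have cyc: "b \<bullet> cross3 c a = a \<bullet> cross3 b c" "c \<bullet> cross3 a b = a \<bullet> cross3 b c"
    by (simp_all add: vec3_simps) (simp_all add: algebra_simps)
  have "(x *\<^sub>R a + y *\<^sub>R b + z *\<^sub>R c) \<bullet> w = 0" for w
    using assms(2) by simp
  from this[of "cross3 b c"] this[of "cross3 c a"] this[of "cross3 a b"]
  show "x = 0" "y = 0" "z = 0"
    using assms(1) by (simp_all add: inner_add_left dot_cross_self cyc)
qed

text \<open>For two bodies at distance r in nonsingular position with product \<open>z\<close>, this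
  is \<open>\<mu>\<close> over the cube of sin r or sinh r.\<close>

definition attraction :: "real \<Rightarrow> real \<Rightarrow> real \<Rightarrow> real" where
  "attraction \<sigma> \<mu> z = \<mu> / (\<sigma> - \<sigma> * z\<^sup>2) powr (3/2)"

lemma attraction_pos: "\<mu> > 0 \<Longrightarrow> \<sigma> - \<sigma> * z\<^sup>2 > 0 \<Longrightarrow> attraction \<sigma> \<mu> z > 0"
  unfolding attraction_def by (intro divide_pos_pos) auto

text \<open>The cubed sine determines the sine, hence the square of the product but not its
  sign.\<close>

lemma attraction_inj:
  assumes "\<mu> > 0" "\<sigma> = 1 \<or> \<sigma> = -1" "\<sigma> - \<sigma> * y\<^sup>2 > 0" "\<sigma> - \<sigma> * z\<^sup>2 > 0"
    and "attraction \<sigma> \<mu> y = attraction \<sigma> \<mu> z"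
  shows "y\<^sup>2 = z\<^sup>2"
proof -
  have "(\<sigma> - \<sigma> * y\<^sup>2) powr (3/2) = (\<sigma> - \<sigma> * z\<^sup>2) powr (3/2)"
    using assms by (simp add: attraction_def field_simps)
  then have "((\<sigma> - \<sigma> * y\<^sup>2) powr (3/2)) powr (2/3) = ((\<sigma> - \<sigma> * z\<^sup>2) powr (3/2)) powr (2/3)"
    by simp
  then have "\<sigma> - \<sigma> * y\<^sup>2 = \<sigma> - \<sigma> * z\<^sup>2"
    using assms(3,4) by (simp add: powr_powr)
  then show ?thesis using assms(2) by auto
qed

text \<open>All terms along \<open>x i\<close>, including the velocity term that keeps the body on
  the surface, are collected in one coefficient \<open>\<kappa>\<close>.\<close>

lemma acceleration_decompose:
  assumes "distinct [i, j, k, l]" "UNIV = {i, j, k, l}" "\<forall>i. m i = \<mu>"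
  shows "\<exists>\<kappa>. acceleration \<sigma> m x v i =
    attraction \<sigma> \<mu> (dot \<sigma> (x i) (x j)) *\<^sub>R x j + attraction \<sigma> \<mu> (dot \<sigma> (x i) (x k)) *\<^sub>R x k
    + attraction \<sigma> \<mu> (dot \<sigma> (x i) (x l)) *\<^sub>R x l - \<kappa> *\<^sub>R x i"
proof -
  have U: "UNIV - {i} = {j, k, l}" using assms by auto
  define g where "g n = dot \<sigma> (x i) (x n)" for n
  have "acceleration \<sigma> m x v i =
      attraction \<sigma> \<mu> (g j) *\<^sub>R x j + attraction \<sigma> \<mu> (g k) *\<^sub>R x k + attraction \<sigma> \<mu> (g l) *\<^sub>R x l
      - (attraction \<sigma> \<mu> (g j) * (\<sigma> * g j) + attraction \<sigma> \<mu> (g k) * (\<sigma> * g k)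
        + attraction \<sigma> \<mu> (g l) * (\<sigma> * g l) + \<sigma> * dot \<sigma> (v i) (v i)) *\<^sub>R x i"
    using assms(1,3) unfolding acceleration_def U g_def[symmetric] attraction_def[symmetric]
    by (simp add: attraction_def[symmetric] scaleR_diff_right scaleR_add_left)
  then show ?thesis unfolding g_def by blast
qed

text \<open>The bodies \<open>i\<close>, \<open>j\<close>, \<open>k\<close>, \<open>l\<close> are in
  cyclic order. Differentiating \<open>par\<close> twice makes their radial coefficients equal; the
  equations for two side vectors and a diagonal sum then decouple, and
  \<open>rotating_frame_factors\<close> compares the factors.\<close>

lemma parallelogram_sides_equal:
  fixes q v :: "4 \<Rightarrow> real \<Rightarrow> real^3"
  assumes \<sigma>: "\<sigma> = 1 \<or> \<sigma> = -1" and \<mu>: "\<mu> > 0" and m: "\<forall>i. m i = \<mu>"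
    and ind: "distinct [i, j, k, l]" "UNIV = {i, j, k, l}"
    and I: "open I" "t \<in> I"
    and vel: "\<And>n s. s \<in> I \<Longrightarrow> (q n has_vector_derivative v n s) (at s)"
    and acc: "\<And>n. (v n has_vector_derivative acceleration \<sigma> m (\<lambda>n. q n t) (\<lambda>n. v n t) n) (at t)"
    and gram: "\<And>n n' s. s \<in> I \<Longrightarrow> dot \<sigma> (q n s) (q n' s) = g n n'"
    and surf: "\<And>n. q n t \<in> surface \<sigma>"
    and ns: "\<And>n n'. n \<noteq> n' \<Longrightarrow> q n t \<noteq> q n' t \<and> q n t \<noteq> - q n' t"
    and par: "\<And>s. s \<in> I \<Longrightarrow> q i s - q j s + q k s - q l s = 0"
    and trip: "q i t \<bullet> cross3 (q j t) (q k t) \<noteq> 0"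
  shows "g i j = g j k"
proof -
  have diag: "g n n = \<sigma>" for n
    using gram[OF I(2), of n n] surface_dot_self[OF \<sigma> surf] by simp
  have gsym: "g n n' = g n' n" for n n'
    using gram[OF I(2), of n n'] gram[OF I(2), of n' n] by (simp add: dot_sym)
  \<comment> \<open>Pairing the parallelogram relation with each vertex gives four linear equations:
    opposite sides agree, and so do the diagonals.\<close>
  have "g n i - g n j + g n k - g n l = 0" for n
    using arg_cong[OF par[OF I(2)], of "dot \<sigma> (q n t)"] by (simp add: gram[OF I(2)])
  from this[of i] this[of j] this[of k] this[of l]
  have opp: "g k l = g i j" "g i l = g j k" "g j l = g i k" and sum: "g i j + g j k = \<sigma> + g i k"
    by (simp_all add: diag gsym[of j i] gsym[of k i] gsym[of l i] gsym[of k j] gsym[of l j] gsym[of l k])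
  define \<alpha> \<beta> \<gamma> where "\<alpha> = attraction \<sigma> \<mu> (g i j)" and "\<beta> = attraction \<sigma> \<mu> (g j k)"
    and "\<gamma> = attraction \<sigma> \<mu> (g i k)"
  have side: "\<sigma> - \<sigma> * (g n n')\<^sup>2 > 0" if "n \<noteq> n'" for n n'
    using side_pos[OF \<sigma> surf surf, of n' n] ns that gram[OF I(2)] by metis
  have pos: "\<alpha> > 0" "\<beta> > 0" "\<gamma> > 0"
    using ind(1) unfolding \<alpha>_def \<beta>_def \<gamma>_def by (auto intro!: attraction_pos[OF \<mu>] side)
  define a b c d where "a = q i t" and "b = q j t" and "c = q k t" and "d = q l t"
  have d: "d = a - b + c" using par[OF I(2)] by (simp add: a_def b_def c_def d_def)
  define A where "A n = acceleration \<sigma> m (\<lambda>n. q n t) (\<lambda>n. v n t) n" for n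
  have dec: "\<exists>\<kappa>. A n1 = attraction \<sigma> \<mu> (g n1 n2) *\<^sub>R q n2 t + attraction \<sigma> \<mu> (g n1 n3) *\<^sub>R q n3 t
      + attraction \<sigma> \<mu> (g n1 n4) *\<^sub>R q n4 t - \<kappa> *\<^sub>R q n1 t"
    if "distinct [n1, n2, n3, n4]" "UNIV = {n1, n2, n3, n4}" for n1 n2 n3 n4
    using acceleration_decompose[OF that m, of \<sigma> "\<lambda>n. q n t" "\<lambda>n. v n t"]
    by (simp add: gram[OF I(2)] A_def)
  obtain \<kappa>i where Ai: "A i = \<alpha> *\<^sub>R b + \<gamma> *\<^sub>R c + \<beta> *\<^sub>R d - \<kappa>i *\<^sub>R a"
    using dec[of i j k l] ind by (auto simp: opp \<alpha>_def \<beta>_def \<gamma>_def a_def b_def c_def d_def)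
  obtain \<kappa>j where Aj: "A j = \<alpha> *\<^sub>R a + \<beta> *\<^sub>R c + \<gamma> *\<^sub>R d - \<kappa>j *\<^sub>R b"
    using dec[of j i k l] ind
    by (auto simp: opp gsym[of j i] insert_commute \<alpha>_def \<beta>_def \<gamma>_def a_def b_def c_def d_def)
  obtain \<kappa>k where Ak: "A k = \<gamma> *\<^sub>R a + \<beta> *\<^sub>R b + \<alpha> *\<^sub>R d - \<kappa>k *\<^sub>R c"
    using dec[of k i j l] ind
    by (auto simp: opp gsym[of k i] gsym[of k j] insert_commute \<alpha>_def \<beta>_def \<gamma>_def a_def b_def c_def d_def)
  obtain \<kappa>l where Al: "A l = \<beta> *\<^sub>R a + \<gamma> *\<^sub>R b + \<alpha> *\<^sub>R c - \<kappa>l *\<^sub>R d"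
    using dec[of l i j k] ind
    by (auto simp: opp gsym[of l i] gsym[of l j] gsym[of l k] insert_commute
        \<alpha>_def \<beta>_def \<gamma>_def a_def b_def c_def d_def)
  have vel0: "v i s - v j s + v k s - v l s = 0" if "s \<in> I" for s
    by (rule constant_on_open_derivative[OF _ I(1) that par])
      (intro has_vector_derivative_add has_vector_derivative_diff; rule vel[OF that])
  have "A i - A j + A k - A l = 0"
    unfolding A_def by (rule constant_on_open_derivative[OF _ I vel0])
      (intro has_vector_derivative_add has_vector_derivative_diff; rule acc)
  \<comment> \<open>The attraction terms cancel in the alternating sum; what remains is a relation
    between the independent vectors \<open>a\<close>, \<open>b\<close>, \<open>c\<close>.\<close>
  then have "(\<kappa>i - \<kappa>l) *\<^sub>R a + (\<kappa>l - \<kappa>j) *\<^sub>R b + (\<kappa>k - \<kappa>l) *\<^sub>R c = 0"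
    unfolding Ai Aj Ak Al d by (simp add: algebra_simps)
  from independent_triple[OF _ this] trip
  have \<kappa>: "\<kappa>i = \<kappa>l" "\<kappa>j = \<kappa>l" "\<kappa>k = \<kappa>l"
    by (auto simp: a_def b_def c_def)
  \<comment> \<open>Two adjacent sides of the Euclidean rectangle and the axis through its centre;
    they are mutually orthogonal.\<close>
  define u where "u s = q i s - q j s" for s
  define w where "w s = q i s - q l s" for s
  define z where "z s = q i s + q k s" for s
  define u' where "u' s = v i s - v j s" for s
  define w' where "w' s = v i s - v l s" for s
  define z' where "z' s = v i s + v k s" for s
  let ?p = "\<beta> - \<alpha> - \<gamma> - \<kappa>l" and ?r = "\<alpha> - \<beta> - \<gamma> - \<kappa>l" and ?k = "\<alpha> + \<beta> + \<gamma> - \<kappa>l"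
  have d1: "(u has_vector_derivative u' s) (at s)" "(w has_vector_derivative w' s) (at s)"
    "(z has_vector_derivative z' s) (at s)" if "s \<in> I" for s
    unfolding u_def w_def z_def u'_def w'_def z'_def
    by (intro has_vector_derivative_add has_vector_derivative_diff; rule vel[OF that])+
  have "(u' has_vector_derivative A i - A j) (at t)" "(w' has_vector_derivative A i - A l) (at t)"
    "(z' has_vector_derivative A i + A k) (at t)"
    unfolding u'_def w'_def z'_def A_def
    by (intro has_vector_derivative_add has_vector_derivative_diff; rule acc)+
  moreover have "A i - A j = ?p *\<^sub>R u t" "A i - A l = ?r *\<^sub>R w t" "A i + A k = ?k *\<^sub>R z t"
    unfolding Ai Aj Ak Al \<kappa> u_def w_def z_def a_def[symmetric] b_def[symmetric] c_def[symmetric]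
      d_def[symmetric] d
    by (simp_all add: algebra_simps)
  ultimately have d2: "(u' has_vector_derivative ?p *\<^sub>R u t) (at t)"
    "(w' has_vector_derivative ?r *\<^sub>R w t) (at t)" "(z' has_vector_derivative ?k *\<^sub>R z t) (at t)"
    by simp_all
  have dots: "dot \<sigma> (u s) (w s) = 0" "dot \<sigma> (u s) (z s) = 0" "dot \<sigma> (w s) (z s) = 0"
    "dot \<sigma> (u s) (u s) = 2 * \<sigma> - 2 * g i j" "dot \<sigma> (w s) (w s) = 2 * \<sigma> - 2 * g j k"
    "dot \<sigma> (z s) (z s) = 2 * \<sigma> + 2 * g i k" if "s \<in> I" for s
    using sum by (simp_all add: u_def w_def z_def gram[OF that] diag opp
        gsym[of j i] gsym[of k i] gsym[of l i] gsym[of k j] gsym[of l j] gsym[of l k])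
  note D = constant_dot_derivatives[OF I(1) _ _ _ I(2)]
  note D1 = D(1)[OF dots(4) d1(1) d1(1)] D(1)[OF dots(5) d1(2) d1(2)] D(1)[OF dots(6) d1(3) d1(3)]
    D(1)[OF dots(1) d1(1) d1(2)] D(1)[OF dots(2) d1(1) d1(3)] D(1)[OF dots(3) d1(2) d1(3)]
  note D2 = D(2)[OF dots(1) d1(1) d1(2) d2(1,2)] D(2)[OF dots(2) d1(1) d1(3) d2(1,3)]
    D(2)[OF dots(3) d1(2) d1(3) d2(2,3)] D(2)[OF dots(4) d1(1) d1(1) d2(1,1)]
    D(2)[OF dots(5) d1(2) d1(2) d2(2,2)] D(2)[OF dots(6) d1(3) d1(3) d2(3,3)]
  have basis: "\<forall>x. dot \<sigma> x (u t) = 0 \<and> dot \<sigma> x (w t) = 0 \<and> dot \<sigma> x (z t) = 0 \<longrightarrow> x = 0"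
  proof (intro allI impI)
    fix x
    assume "dot \<sigma> x (u t) = 0 \<and> dot \<sigma> x (w t) = 0 \<and> dot \<sigma> x (z t) = 0"
    then have "dot \<sigma> x a = 0" "dot \<sigma> x b = 0" "dot \<sigma> x c = 0"
      unfolding u_def w_def z_def a_def[symmetric] b_def[symmetric] c_def[symmetric]
        d_def[symmetric] d by auto
    then have "flip3 \<sigma> x = 0"
      using triple_product_zero[of "flip3 \<sigma> x" a b c] trip
      by (auto simp: flip3_inner a_def b_def c_def)
    then show "x = 0" using \<sigma> by (auto simp: flip3_eq_0)
  qed
  have nz: "u t \<noteq> 0" "w t \<noteq> 0" "z t \<noteq> 0"
    using ns[of i j] ns[of i l] ns[of i k] ind(1)
    by (auto simp: u_def w_def z_def eq_neg_iff_add_eq_0)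
  note ort = dots(1-3)[OF I(2)]
  have "?p = ?r"
  proof (rule rotating_frame_factors[OF basis ort nz])
    show "dot \<sigma> (u' t) (u t) = 0" "dot \<sigma> (w' t) (w t) = 0" "dot \<sigma> (z' t) (z t) = 0"
      using D1(1-3) dot_sym[of \<sigma> "u t" "u' t"] dot_sym[of \<sigma> "w t" "w' t"] dot_sym[of \<sigma> "z t" "z' t"]
      by simp_all
    show "dot \<sigma> (u' t) (w t) + dot \<sigma> (u t) (w' t) = 0" "dot \<sigma> (u' t) (z t) + dot \<sigma> (u t) (z' t) = 0"
      "dot \<sigma> (w' t) (z t) + dot \<sigma> (w t) (z' t) = 0"
      by (rule D1(4-6); assumption)+
    show "dot \<sigma> (u' t) (w' t) = 0" "dot \<sigma> (u' t) (z' t) = 0" "dot \<sigma> (w' t) (z' t) = 0"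
      "dot \<sigma> (u' t) (u' t) = - ?p * dot \<sigma> (u t) (u t)"
      "dot \<sigma> (w' t) (w' t) = - ?r * dot \<sigma> (w t) (w t)"
      "dot \<sigma> (z' t) (z' t) = - ?k * dot \<sigma> (z t) (z t)"
      using D2 ort by (simp_all add: algebra_simps)
    \<comment> \<open>The differences are \<open>2 * (\<alpha> + \<gamma>)\<close> and
      \<open>2 * (\<beta> + \<gamma>)\<close>, both positive.\<close>
    show "?k \<noteq> ?p" "?k \<noteq> ?r" using pos by auto
  qed
  then have "\<alpha> = \<beta>" by simp
  then have "(g i j)\<^sup>2 = (g j k)\<^sup>2"
    using attraction_inj[OF \<mu> \<sigma>] side[of i j] side[of j k] ind(1)
    by (simp add: \<alpha>_def \<beta>_def)
  \<comment> \<open>With opposite signs, \<open>sum\<close> would give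
    \<open>g i k = - \<sigma>\<close>, so \<open>z t\<close> would be null.\<close>
  moreover have "g i j \<noteq> - g j k"
    using orthogonal_expansion(3)[OF basis ort nz] sum dots(6)[OF I(2)] by simp
  ultimately show ?thesis by (simp add: power2_eq_iff)
qed


section \<open>From the shape at one instant to the whole motion\<close>

theorem theorem2:
  fixes \<sigma> \<mu> :: real and m :: "4 \<Rightarrow> real" and I :: "real set"
    and q :: "4 \<Rightarrow> real \<Rightarrow> real^3"
  assumes "\<sigma> = 1 \<or> \<sigma> = -1"
    and "\<mu> > 0" and "\<forall>i. m i = \<mu>"
    and "relative_equilibrium \<sigma> m I q"
    and "rectangular_motion \<sigma> I q"
  shows "square_motion \<sigma> I q"
  unfolding square_motion_def
proof
  note \<sigma> = assms(1)
  fix t assume t: "t \<in> I"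
  have sol: "curved_solution \<sigma> m I q"
    using assms(4) unfolding relative_equilibrium_def by blast
  have geo: "geo_dist \<sigma> (q n s) (q n' s) = geo_dist \<sigma> (q n t) (q n' t)" if "s \<in> I" for n n' s
    using assms(4) that t unfolding relative_equilibrium_def by blast
  have openI: "open I"
    using sol unfolding curved_solution_def by blast
  have ns: "q n t \<noteq> q n' t \<and> q n t \<noteq> - q n' t" if "n \<noteq> n'" for n n'
    using sol t that unfolding curved_solution_def by blast
  obtain v where v: "\<forall>t\<in>I. \<forall>i. (q i has_vector_derivative v i t) (at t) \<and>
      (v i has_vector_derivative acceleration \<sigma> m (\<lambda>j. q j t) (\<lambda>j. v j t) i) (at t)"
    using sol unfolding curved_solution_def by (elim conjE exE)
  have vel: "(q n has_vector_derivative v n s) (at s)" if "s \<in> I" for n s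
    using v that by blast
  have acc: "(v n has_vector_derivative acceleration \<sigma> m (\<lambda>n. q n t) (\<lambda>n. v n t) n) (at t)" for n
    using v t by blast
  have rect: "\<exists>a b c d. range (\<lambda>i. q i s) = {a, b, c, d} \<and> geodesic_rectangle \<sigma> a b c d" if "s \<in> I" for s
    using assms(5) that unfolding rectangular_motion_def by blast
  have surf: "range (\<lambda>n. q n s) \<subseteq> surface \<sigma>" if "s \<in> I" for s
    using rect[OF that] unfolding geodesic_rectangle_def geodesic_quadrilateral_def by metis
  \<comment> \<open>Not lying on a geodesic means that the four bodies span the space.\<close>
  have free: "x = 0" if "s \<in> I" "\<forall>n. dot \<sigma> x (q n s) = 0" for x s
  proof -
    have "\<not> (\<exists>G. geodesic \<sigma> G \<and> range (\<lambda>n. q n s) \<subseteq> G)"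
      using rect[OF that(1)] unfolding geodesic_rectangle_def by metis
    then have "flip3 \<sigma> x = 0"
      by (rule not_on_geodesic[OF _ surf[OF that(1)]]) (use that(2) in \<open>auto simp: flip3_inner\<close>)
    then show ?thesis using \<sigma> by (auto simp: flip3_eq_0)
  qed
  define g where "g n n' = dot \<sigma> (q n t) (q n' t)" for n n'
  have gram: "dot \<sigma> (q n s) (q n' s) = g n n'" if "s \<in> I" for n n' s
    using geo[OF that, of n n'] geo_dist_eq_iff[OF \<sigma>] surf[OF that] surf[OF t]
    unfolding g_def by (metis range_subsetD)
  obtain a b c d where ran: "range (\<lambda>i. q i t) = {a, b, c, d}" and R: "geodesic_rectangle \<sigma> a b c d"
    using rect[OF t] by blast
  have "{a, b, c, d} \<subseteq> range (\<lambda>i. q i t)" using ran by simp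
  then obtain i j k l where q: "a = q i t" "b = q j t" "c = q k t" "d = q l t" by auto
  have "distinct [a, b, c, d]"
    using R unfolding geodesic_rectangle_def geodesic_quadrilateral_def by blast
  then have dist: "distinct [i, j, k, l]" using q by auto
  have univ: "UNIV = {i, j, k, l}"
  proof -
    have "n \<in> {i, j, k, l}" for n
    proof -
      have "q n t \<in> {q i t, q j t, q k t, q l t}" using ran q by blast
      then show ?thesis using ns by blast
    qed
    then show ?thesis by blast
  qed
  note P = geodesic_rectangle_parallelogram[OF \<sigma> R, unfolded q]
  have bal: "g i n - g j n + g k n - g l n = 0" for n
    using arg_cong[OF P(1), of "\<lambda>x. dot \<sigma> x (q n t)"] by (simp add: g_def)
  \<comment> \<open>The hypothesis allows the cyclic order of the bodies to vary with time. With the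
    labels chosen at \<open>t\<close>, the alternating sum is orthogonal to every body at every
    time, since all products are constant.\<close>
  have par: "q i s - q j s + q k s - q l s = 0" if "s \<in> I" for s
    by (rule free[OF that]) (simp add: gram[OF that] bal)
  have eq: "g i j = g j k"
    by (rule parallelogram_sides_equal[OF \<sigma> assms(2,3) dist univ openI t vel acc gram _ _ par P(2)])
      (use ns surf[OF t] in auto)
  have gsym: "g n n' = g n' n" and diag: "g n n = \<sigma>" for n n'
    using surface_dot_self[OF \<sigma>] surf[OF t] by (auto simp: g_def dot_sym)
  have "g k l = g i j" "g l i = g j k"
    using bal[of i] bal[of j] bal[of k] bal[of l]
    by (simp_all add: diag gsym[of j i] gsym[of k i] gsym[of l i] gsym[of k j] gsym[of l j] gsym[of l k])
  with eq have "equilateral \<sigma> a b c d"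
    unfolding equilateral_def geo_dist_def q g_def[symmetric] by simp
  then have "geodesic_square \<sigma> a b c d"
    using R unfolding geodesic_square_def geodesic_rectangle_def by blast
  with ran show "\<exists>a b c d. range (\<lambda>i. q i t) = {a, b, c, d} \<and> geodesic_square \<sigma> a b c d"
    by blast
qed

end
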